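(* Let $B$ be a bounded set in $\mathbb{R}^d$, let $C_1 = C_1(B)$ be a constant such that $|f(x)| \leq C_1 |i(x)|$ for all $x \in B$, let $C_2 := C_1 + \tfrac{1}{5}$, and suppose that $R$, $L$ and $H$ are positive constants such that 1. $\tilde{f} : \mathbb{R}^d \times \mathbb{R}^d \times [0,\infty) \to \mathbb{R}^d$ is an $(R,L,H)$-approximation of $f$ on $B$, and 2. $\tilde{i} : \mathbb{R}^d \times \mathbb{R}^d \times [0,\infty) \to \mathbb{R}^d$ is an $(R,L,H)$-approximation of $i$ on $B$. Define $$R' := \max\{R, 10L\} \quad \text{and} \quad H' := \min\left\{ H, \tfrac{1}{10L}, \tfrac{1}{6 C_2 R'}, \tfrac{1}{(36 C_2 + 6)L} \right\}.$$ Then for each $x \in B$ and $h \in [0,H')$, there exists a unique $x' \in B_{R'}(x)$ and $\lambda \in \mathbb{R}$ such that $|\lambda| \leq \tfrac{11}{5} C_2 h$ satisfying $$x' = x + h \tilde{f}(x,x',h) + \lambda\, \tilde{i}(x,x',h) \quad \text{and} \quad I(x') = I(x).$$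
   Context: Setting: $d \in \mathbb{N}$; $f : \mathbb{R}^d \to \mathbb{R}^d$ is locally Lipschitz continuous; the ODE $\dot{x} = f(x)$ has a first integral $I : \mathbb{R}^d \to \mathbb{R}$ ($I$ is constant along solutions); $I$ is a Morse function (smooth with non-degenerate critical points); $i := \nabla I$ is locally Lipschitz continuous. $|\cdot|$ is the Euclidean norm. For each bounded set $B$ a constant $C_1 = C_1(B)$ with $|f| \le C_1 |i|$ on $B$ exists. For $x \in \mathbb{R}^d$ and $R > 0$, $B_R(x) := \{ z \in \mathbb{R}^d : |z - x| \leq |i(x)|/R \}$ (note the radius $|i(x)|/R$; $B_R(x) = \{x\}$ if $i(x) = 0$). For $\varphi \in \{f, i\}$, a bounded set $B$ and positive constants $R, L, H$, a map $\tilde{\varphi} : \mathbb{R}^d \times \mathbb{R}^d \times [0,\infty) \to \mathbb{R}^d$ is called an $(R,L,H)$-approximation of $\varphi$ on $B$ if for all $x \in B$, all $u,v,w \in B_R(x)$ and all $h \in [0,H)$: $\tilde{\varphi}(x,x,0) = \varphi(x)$; $|\tilde{\varphi}(u,v,h) - \tilde{\varphi}(w,v,h)| \leq L|u-w|$; $|\tilde{\varphi}(u,v,h) - \tilde{\varphi}(u,w,h)| \leq L|v-w|$; $|\tilde{\varphi}(x,x,h) - \tilde{\varphi}(x,x,0)| \leq L h |i(x)|$.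
   Formalization: False as stated. Added: ĩ(u,u,0)=i(u) for all u in B_{R'}(x), x in B (the definition gives this only on B). At x with i(x)=0 and h>0 every admissible λ works, so only x' is claimed unique there; the pair (x',λ) is claimed unique when i(x)≠0 or h=0. *)

theory Defs
  imports "HOL-Analysis.Analysis"
begin

definition partial_derivative :: "'n \<Rightarrow> (real ^ 'n \<Rightarrow> real) \<Rightarrow> real ^ 'n \<Rightarrow> real"
  where "partial_derivative j g x = frechet_derivative g (at x) (axis j 1)"

definition gradient :: "(real ^ 'n \<Rightarrow> real) \<Rightarrow> real ^ 'n \<Rightarrow> real ^ 'n"
  where "gradient g x = (\<chi> j. partial_derivative j g x)"

fun k_times_cont_diff :: "nat \<Rightarrow> (real ^ 'n \<Rightarrow> real) \<Rightarrow> bool"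
  where
    "k_times_cont_diff 0 g \<longleftrightarrow> continuous_on UNIV g"
  | "k_times_cont_diff (Suc k) g \<longleftrightarrow>
       g differentiable_on UNIV \<and> (\<forall>j. k_times_cont_diff k (partial_derivative j g))"

definition smooth :: "(real ^ 'n \<Rightarrow> real) \<Rightarrow> bool"
  where "smooth g \<longleftrightarrow> (\<forall>k. k_times_cont_diff k g)"

text \<open>The Hessian is the Jacobian of the gradient.\<close>

definition morse :: "(real ^ 'n \<Rightarrow> real) \<Rightarrow> bool"
  where "morse g \<longleftrightarrow>
    smooth g \<and> (\<forall>x. gradient g x = 0 \<longrightarrow> invertible (jacobian (gradient g) (at x)))"

text \<open>The time argument of \<^const>\<open>local_lipschitz\<close> is a dummy, as the vector fields here are
  autonomous.\<close>

definition locally_lipschitz :: "(real ^ 'n \<Rightarrow> real ^ 'n) \<Rightarrow> bool"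
  where "locally_lipschitz \<phi> \<longleftrightarrow> local_lipschitz (UNIV :: real set) UNIV (\<lambda>t. \<phi>)"

definition first_integral :: "(real ^ 'n \<Rightarrow> real ^ 'n) \<Rightarrow> (real ^ 'n \<Rightarrow> real) \<Rightarrow> bool"
  where "first_integral f I \<longleftrightarrow>
    (\<forall>(T :: real set) y. is_interval T
        \<and> (\<forall>t\<in>T. (y has_vector_derivative f (y t)) (at t within T))
      \<longrightarrow> (\<lambda>t. I (y t)) constant_on T)"

definition grad_ball :: "(real ^ 'n \<Rightarrow> real ^ 'n) \<Rightarrow> real \<Rightarrow> real ^ 'n \<Rightarrow> (real ^ 'n) set"
  where "grad_ball i R x = cball x (norm (i x) / R)"

text \<open>Only the values \<open>\<phi>t u v h\<close> with \<open>h \<ge> 0\<close> are ever used. The first clause ties \<open>\<phi>t\<close> to \<open>\<phi>\<close>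
  only at the points of \<open>B\<close>, although the other clauses range over balls that may leave \<open>B\<close>. So
  \<open>\<phi>t u u 0 = \<phi> u\<close> for a point \<open>u\<close> of such a ball outside \<open>B\<close> does not follow from this definition.\<close>

definition approximation ::
  "(real ^ 'n \<Rightarrow> real ^ 'n) \<Rightarrow> (real ^ 'n \<Rightarrow> real ^ 'n) \<Rightarrow> (real ^ 'n) set
    \<Rightarrow> real \<Rightarrow> real \<Rightarrow> real \<Rightarrow> (real ^ 'n \<Rightarrow> real ^ 'n \<Rightarrow> real \<Rightarrow> real ^ 'n) \<Rightarrow> bool"
  where "approximation i \<phi> B R L H \<phi>t \<longleftrightarrow>
    (\<forall>x\<in>B. \<forall>u\<in>grad_ball i R x. \<forall>v\<in>grad_ball i R x. \<forall>w\<in>grad_ball i R x. \<forall>h\<in>{0..<H}.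
        \<phi>t x x 0 = \<phi> x
      \<and> norm (\<phi>t u v h - \<phi>t w v h) \<le> L * norm (u - w)
      \<and> norm (\<phi>t u v h - \<phi>t u w h) \<le> L * norm (v - w)
      \<and> norm (\<phi>t x x h - \<phi>t x x 0) \<le> L * h * norm (i x))"

definition projection_step ::
  "(real ^ 'n \<Rightarrow> real)
    \<Rightarrow> (real ^ 'n \<Rightarrow> real ^ 'n \<Rightarrow> real \<Rightarrow> real ^ 'n)
    \<Rightarrow> (real ^ 'n \<Rightarrow> real ^ 'n \<Rightarrow> real \<Rightarrow> real ^ 'n)
    \<Rightarrow> real \<Rightarrow> real ^ 'n \<Rightarrow> real ^ 'n \<Rightarrow> real \<Rightarrow> bool"
  where "projection_step I ft it h x x' l \<longleftrightarrow>
    x' = x + h *\<^sub>R ft x x' h + l *\<^sub>R it x x' h \<and> I x' = I x"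

end

theory Submission
  imports Defs
begin

text \<open>
  Let \<open>g y\<close> be the average of \<open>\<nabla>I\<close> over the segment from \<open>x\<close> to \<open>y\<close>. Since
  \<open>I y - I x = g y \<bullet> (y - x)\<close>, the constraint \<open>I y = I x\<close> along
  \<open>y - x = h f + l k\<close> (where \<open>f\<close>, \<open>k\<close> are the two approximations evaluated at \<open>(x, y, h)\<close>) is linear in
  the multiplier and forces \<open>l = - h (g \<bullet> f) / (g \<bullet> k)\<close>. Both \<open>g\<close> and \<open>k\<close> are within
  \<open>|\<nabla>I x| / 5\<close> of \<open>\<nabla>I x\<close>, so the denominator stays away from zero, and substituting \<open>l\<close> turns the
  problem into a fixed-point equation for \<open>y\<close> alone, whose right-hand side is a contraction of
  the ball of radius \<open>|\<nabla>I x| / R'\<close>. Critical points \<open>x\<close> are trivial because the ball degenerates to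
  \<open>{x}\<close>.
\<close>

section \<open>Gradients and their averages along segments\<close>

lemma has_derivative_gradient:
  fixes g :: "real ^ 'n \<Rightarrow> real"
  assumes "g differentiable (at x)"
  shows "(g has_derivative (\<lambda>v. gradient g x \<bullet> v)) (at x)"
proof -
  let ?D = "frechet_derivative g (at x)"
  have D: "(g has_derivative ?D) (at x)"
    using assms frechet_derivative_works by blast
  then have lin: "linear ?D"
    by (simp add: has_derivative_linear)
  have "?D v = gradient g x \<bullet> v" for v
  proof -
    have "?D v = ?D (\<Sum>j\<in>UNIV. v $ j *\<^sub>R axis j 1)"
      by (simp add: basis_expansion flip: scalar_mult_eq_scaleR)
    also have "\<dots> = (\<Sum>j\<in>UNIV. v $ j * ?D (axis j 1))"
      by (simp add: linear_sum[OF lin] linear_cmul[OF lin])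
    finally show ?thesis
      by (simp add: inner_vec_def gradient_def partial_derivative_def mult.commute)
  qed
  then have "?D = (\<lambda>v. gradient g x \<bullet> v)"
    by blast
  with D show ?thesis
    by simp
qed

text \<open>This is the mean value discrete gradient, also known from the averaged vector field
  method.\<close>

definition mean_gradient :: "(real ^ 'n \<Rightarrow> real) \<Rightarrow> real ^ 'n \<Rightarrow> real ^ 'n \<Rightarrow> real ^ 'n"
  where "mean_gradient g x y = integral {0..1} (\<lambda>s. gradient g (x + s *\<^sub>R (y - x)))"

lemma continuous_on_gradient_segment:
  assumes "continuous_on UNIV (gradient g)"
  shows "continuous_on {0..1::real} (\<lambda>s. gradient g (x + s *\<^sub>R (y - x)))"
  by (rule continuous_on_compose2[OF assms]) (auto intro!: continuous_intros)

text \<open>Integrate the derivative of \<open>g\<close> along the segment and pull the constant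
  vector \<open>y - x\<close> out of the integral. There is no remainder term, so conservation
  becomes an exact orthogonality condition.\<close>

lemma diff_eq_mean_gradient:
  fixes g :: "real ^ 'n \<Rightarrow> real"
  assumes "g differentiable_on UNIV" "continuous_on UNIV (gradient g)"
  shows "g y - g x = mean_gradient g x y \<bullet> (y - x)"
proof -
  let ?c = "\<lambda>s::real. x + s *\<^sub>R (y - x)"
  have "((\<lambda>s. g (?c s)) has_vector_derivative gradient g (?c s) \<bullet> (y - x)) (at s within {0..1})" for s
  proof -
    have "(g has_derivative (\<lambda>v. gradient g (?c s) \<bullet> v)) (at (?c s))"
      using assms(1) by (intro has_derivative_gradient) (simp add: differentiable_on_def)
    moreover have "(?c has_derivative (\<lambda>t. t *\<^sub>R (y - x))) (at s within {0..1})"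
      by (auto intro!: derivative_eq_intros)
    ultimately have "((\<lambda>s. g (?c s)) has_derivative (\<lambda>t. gradient g (?c s) \<bullet> (t *\<^sub>R (y - x))))
        (at s within {0..1})"
      by (rule has_derivative_compose[rotated])
    then show ?thesis
      by (simp add: has_vector_derivative_def)
  qed
  then have "((\<lambda>s. gradient g (?c s) \<bullet> (y - x)) has_integral g (?c 1) - g (?c 0)) {0..1}"
    by (intro fundamental_theorem_of_calculus) auto
  moreover have "((\<lambda>s. gradient g (?c s) \<bullet> (y - x)) has_integral mean_gradient g x y \<bullet> (y - x)) {0..1}"
    unfolding mean_gradient_def
    by (rule has_integral_linear[OF _ bounded_linear_inner_left, unfolded o_def])
      (intro integrable_integral integrable_continuous_interval continuous_on_gradient_segment assms)
  ultimately have "g (?c 1) - g (?c 0) = mean_gradient g x y \<bullet> (y - x)"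
    by (rule has_integral_unique)
  then show ?thesis
    by simp
qed

lemma mean_gradient_refl: "mean_gradient g x x = gradient g x"
  by (simp add: mean_gradient_def)

text \<open>Convexity keeps both segments from \<open>x\<close> inside \<open>S\<close>, and their
  points at parameter \<open>s\<close> differ by \<open>s\<close> times \<open>u - w\<close>. The
  factor \<open>s\<close> would integrate to 1/2; bounding it by 1 is enough below.\<close>

lemma norm_mean_gradient_diff_le:
  fixes g :: "real ^ 'n \<Rightarrow> real"
  assumes cont: "continuous_on UNIV (gradient g)" and "convex S" and K: "K \<ge> 0"
    and lip: "\<And>u w. u \<in> S \<Longrightarrow> w \<in> S \<Longrightarrow> norm (gradient g u - gradient g w) \<le> K * norm (u - w)"
    and S: "x \<in> S" "u \<in> S" "w \<in> S"
  shows "norm (mean_gradient g x u - mean_gradient g x w) \<le> K * norm (u - w)"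
proof -
  let ?f = "\<lambda>y s::real. gradient g (x + s *\<^sub>R (y - x))"
  note c = continuous_on_gradient_segment[OF cont]
  have "norm (?f u s - ?f w s) \<le> K * norm (u - w)" if s: "s \<in> {0..1}" for s
  proof -
    have *: "x + s *\<^sub>R (y - x) \<in> S" if "y \<in> S" for y
      using convexD_alt[OF \<open>convex S\<close> \<open>x \<in> S\<close> that, of s] s by (simp add: algebra_simps)
    have "norm (?f u s - ?f w s) \<le> K * norm ((x + s *\<^sub>R (u - x)) - (x + s *\<^sub>R (w - x)))"
      by (intro lip * S)
    also have "(x + s *\<^sub>R (u - x)) - (x + s *\<^sub>R (w - x)) = s *\<^sub>R (u - w)"
      by (simp add: algebra_simps)
    also have "K * norm (s *\<^sub>R (u - w)) \<le> K * norm (u - w)"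
      using s K by (auto intro!: mult_left_mono mult_left_le_one_le)
    finally show ?thesis .
  qed
  then have "norm (integral {0..1} (\<lambda>s. ?f u s - ?f w s)) \<le> K * norm (u - w) * (1 - 0)"
    by (intro integral_bound continuous_on_diff c) auto
  also have "integral {0..1} (\<lambda>s. ?f u s - ?f w s) = mean_gradient g x u - mean_gradient g x w"
    unfolding mean_gradient_def
    by (intro integral_diff integrable_continuous_interval c)
  finally show ?thesis
    by simp
qed

section \<open>Estimates for the multiplier near a nonzero gradient\<close>

text \<open>Expand around \<open>p\<close>: the two linear errors cost 1/5 each and the quadratic
  one 1/25, and 1 - 1/5 - 1/5 - 1/25 = 14/25.\<close>

lemma inner_ge_near:
  fixes p g k :: "'a::real_inner"
  assumes "norm (g - p) \<le> norm p / 5" "norm (k - p) \<le> norm p / 5"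
  shows "g \<bullet> k \<ge> 14 / 25 * (norm p)\<^sup>2"
proof -
  have eq: "g \<bullet> k = (norm p)\<^sup>2 + p \<bullet> (k - p) + (g - p) \<bullet> p + (g - p) \<bullet> (k - p)"
    by (simp add: power2_norm_eq_inner algebra_simps inner_commute)
  have "\<bar>p \<bullet> (k - p)\<bar> \<le> norm p * (norm p / 5)"
    using assms by (intro order_trans[OF Cauchy_Schwarz_ineq2] mult_mono) auto
  moreover have "\<bar>(g - p) \<bullet> p\<bar> \<le> (norm p / 5) * norm p"
    using assms by (intro order_trans[OF Cauchy_Schwarz_ineq2] mult_mono) auto
  moreover have "\<bar>(g - p) \<bullet> (k - p)\<bar> \<le> (norm p / 5) * (norm p / 5)"
    using assms by (intro order_trans[OF Cauchy_Schwarz_ineq2] mult_mono) auto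
  ultimately show ?thesis
    unfolding eq power2_eq_square by linarith
qed

lemma norm_le_near:
  fixes p g :: "'a::real_normed_vector"
  assumes "norm (g - p) \<le> norm p / 5"
  shows "norm g \<le> 6 / 5 * norm p"
  using norm_triangle_sub[of g p] assms by simp

text \<open>Sign and step size are split off: the multiplier of the scheme is \<open>- h\<close>
  times this quotient. If \<open>g\<close> and \<open>k\<close> are not orthogonal, subtracting
  \<open>multiplier f g k\<close> times \<open>k\<close> from \<open>f\<close> projects
  \<open>f\<close> along \<open>k\<close> onto the hyperplane orthogonal to
  \<open>g\<close>.\<close>

definition multiplier :: "'a::real_inner \<Rightarrow> 'a \<Rightarrow> 'a \<Rightarrow> real"
  where "multiplier f g k = (g \<bullet> f) / (g \<bullet> k)"

lemma abs_multiplier_le: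
  fixes p f g k :: "'a::real_inner"
  assumes p: "p \<noteq> 0"
    and f: "norm f \<le> C * norm p"
    and g: "norm (g - p) \<le> norm p / 5" and k: "norm (k - p) \<le> norm p / 5"
  shows "\<bar>multiplier f g k\<bar> \<le> 11 / 5 * C"
proof -
  have C: "C \<ge> 0"
    using f p by (metis norm_ge_zero order_trans zero_le_mult_iff zero_less_norm_iff linorder_not_le)
  have D: "g \<bullet> k \<ge> 14 / 25 * (norm p)\<^sup>2"
    by (rule inner_ge_near[OF g k])
  have Dpos: "g \<bullet> k > 0"
    by (rule less_le_trans[OF _ D]) (use p in simp)
  have "\<bar>g \<bullet> f\<bar> \<le> (6 / 5 * norm p) * (C * norm p)"
    using norm_le_near[OF g] f by (intro order_trans[OF Cauchy_Schwarz_ineq2] mult_mono) auto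
  also have "\<dots> = 6 / 5 * (C * (norm p)\<^sup>2)"
    by (simp add: power2_eq_square)
  \<comment> \<open>The exact quotient of 6/5 by 14/25 is 15/7, which is rounded up to 11/5.\<close>
  also have "\<dots> \<le> 11 / 5 * 14 / 25 * (C * (norm p)\<^sup>2)"
    using C by (intro mult_right_mono) auto
  also have "\<dots> = 11 / 5 * C * (14 / 25 * (norm p)\<^sup>2)"
    by simp
  also have "\<dots> \<le> 11 / 5 * C * (g \<bullet> k)"
    using C D by (intro mult_left_mono) auto
  finally show ?thesis
    using Dpos by (simp add: multiplier_def abs_divide pos_divide_le_eq)
qed

text \<open>This yields the contraction constant. In the application \<open>e\<close> is
  \<open>L * norm (u - w)\<close>; the bound on \<open>g1 - g2\<close> is \<open>2 * e\<close>
  because the gradient is only shown to be Lipschitz with constant \<open>2 * L\<close>.\<close>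

lemma norm_multiplier_correction_diff_le:
  fixes p f1 f2 g1 g2 k1 k2 :: "'a::real_inner"
  assumes p: "p \<noteq> 0"
    and f: "norm f1 \<le> C * norm p" "norm f2 \<le> C * norm p"
    and g: "norm (g1 - p) \<le> norm p / 5" "norm (g2 - p) \<le> norm p / 5"
    and k: "norm (k1 - p) \<le> norm p / 5" "norm (k2 - p) \<le> norm p / 5"
    and df: "norm (f1 - f2) \<le> e" and dg: "norm (g1 - g2) \<le> 2 * e" and dk: "norm (k1 - k2) \<le> e"
  shows "norm ((f1 - multiplier f1 g1 k1 *\<^sub>R k1) - (f2 - multiplier f2 g2 k2 *\<^sub>R k2)) \<le> (36 * C + 6) * e"
proof -
  let ?m = "norm p"
  let ?q1 = "multiplier f1 g1 k1" and ?q2 = "multiplier f2 g2 k2"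
  have m: "?m > 0"
    using p by simp
  have C: "C \<ge> 0"
    using f p by (metis norm_ge_zero order_trans zero_le_mult_iff zero_less_norm_iff linorder_not_le)
  have e: "e \<ge> 0"
    using df norm_ge_zero order_trans by blast
  note CS = order_trans[OF Cauchy_Schwarz_ineq2]
  have D1: "g1 \<bullet> k1 \<ge> 14 / 25 * ?m\<^sup>2" and D2: "g2 \<bullet> k2 \<ge> 14 / 25 * ?m\<^sup>2"
    using inner_ge_near g k by blast+
  have Dpos: "g1 \<bullet> k1 > 0" "g2 \<bullet> k2 > 0"
    by (rule less_le_trans[OF _ D1], use m in simp) (rule less_le_trans[OF _ D2], use m in simp)
  have q2: "\<bar>?q2\<bar> \<le> 11 / 5 * C"
    by (rule abs_multiplier_le[OF p f(2) g(2) k(2)])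
  \<comment> \<open>For quotients q = N / D, (q1 - q2) D1 = (N1 - N2) - q2 (D1 - D2). Only the first
    denominator then has to be divided out, and the bound on \<open>?q2\<close> controls the
    rest.\<close>
  have eq: "(?q1 - ?q2) * (g1 \<bullet> k1) =
      (g1 - g2) \<bullet> f1 + g2 \<bullet> (f1 - f2) - ?q2 * ((g1 - g2) \<bullet> k1 + g2 \<bullet> (k1 - k2))"
  proof -
    have "?q1 * (g1 \<bullet> k1) = g1 \<bullet> f1" "?q2 * (g2 \<bullet> k2) = g2 \<bullet> f2"
      using Dpos by (simp_all add: multiplier_def)
    then show ?thesis
      by (simp add: algebra_simps)
  qed
  have a1: "\<bar>(g1 - g2) \<bullet> f1\<bar> \<le> (2 * e) * (C * ?m)"
    using dg f e by (intro CS mult_mono) auto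
  have a2: "\<bar>g2 \<bullet> (f1 - f2)\<bar> \<le> (6 / 5 * ?m) * e"
    using norm_le_near[OF g(2)] df by (intro CS mult_mono) auto
  have a3: "\<bar>(g1 - g2) \<bullet> k1\<bar> \<le> (2 * e) * (6 / 5 * ?m)"
    using norm_le_near[OF k(1)] dg e by (intro CS mult_mono) auto
  have a4: "\<bar>g2 \<bullet> (k1 - k2)\<bar> \<le> (6 / 5 * ?m) * e"
    using norm_le_near[OF g(2)] dk by (intro CS mult_mono) auto
  have "\<bar>(g1 - g2) \<bullet> k1 + g2 \<bullet> (k1 - k2)\<bar> \<le> 18 / 5 * (e * ?m)"
    using abs_triangle_ineq[of "(g1 - g2) \<bullet> k1" "g2 \<bullet> (k1 - k2)"] a3 a4
    by (simp add: mult.commute)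
  then have a5: "\<bar>?q2 * ((g1 - g2) \<bullet> k1 + g2 \<bullet> (k1 - k2))\<bar> \<le> 11 / 5 * C * (18 / 5 * (e * ?m))"
    unfolding abs_mult using q2 C by (intro mult_mono) auto
  have "\<bar>?q1 - ?q2\<bar> * (14 / 25 * ?m\<^sup>2) \<le> \<bar>?q1 - ?q2\<bar> * (g1 \<bullet> k1)"
    using D1 by (intro mult_left_mono) auto
  also have "\<dots> = \<bar>(?q1 - ?q2) * (g1 \<bullet> k1)\<bar>"
    using Dpos by (simp add: abs_mult)
  also have "\<dots> \<le> (2 * e) * (C * ?m) + (6 / 5 * ?m) * e + 11 / 5 * C * (18 / 5 * (e * ?m))"
    unfolding eq using a1 a2 a5 by linarith
  \<comment> \<open>Here 248/25 = 2 + (11/5)(18/5).\<close>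
  also have "\<dots> = (248 / 25 * C + 6 / 5) * e * ?m"
    by (simp add: algebra_simps)
  finally have "(\<bar>?q1 - ?q2\<bar> * (14 / 25 * ?m)) * ?m \<le> ((248 / 25 * C + 6 / 5) * e) * ?m"
    by (simp add: power2_eq_square mult.assoc)
  then have "\<bar>?q1 - ?q2\<bar> * (14 / 25 * ?m) \<le> (248 / 25 * C + 6 / 5) * e"
    using m mult_right_le_imp_le by blast
  \<comment> \<open>The factor 15/7 is 6/5 divided by 14/25.\<close>
  then have q12: "\<bar>?q1 - ?q2\<bar> * (6 / 5 * ?m) \<le> 15 / 7 * ((248 / 25 * C + 6 / 5) * e)"
    by linarith
  have b1: "norm ((?q1 - ?q2) *\<^sub>R k1) \<le> \<bar>?q1 - ?q2\<bar> * (6 / 5 * ?m)"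
    unfolding norm_scaleR using norm_le_near[OF k(1)] by (intro mult_left_mono) auto
  have b2: "norm (?q2 *\<^sub>R (k1 - k2)) \<le> 11 / 5 * C * e"
    unfolding norm_scaleR using q2 dk C by (intro mult_mono) auto
  have "(f1 - ?q1 *\<^sub>R k1) - (f2 - ?q2 *\<^sub>R k2) = (f1 - f2) - (?q1 - ?q2) *\<^sub>R k1 - ?q2 *\<^sub>R (k1 - k2)"
    by (simp add: algebra_simps)
  also have "norm \<dots> \<le> norm (f1 - f2) + norm ((?q1 - ?q2) *\<^sub>R k1) + norm (?q2 *\<^sub>R (k1 - k2))"
    by (smt (verit) norm_triangle_ineq4)
  also have "\<dots> \<le> e + 15 / 7 * ((248 / 25 * C + 6 / 5) * e) + 11 / 5 * C * e"
    using df b1 b2 q12 by linarith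
  \<comment> \<open>The constants actually obtained are below 24 for \<open>C * e\<close> and below
    4 for \<open>e\<close>.\<close>
  also have "\<dots> \<le> (36 * C + 6) * e"
    using mult_nonneg_nonneg[OF C e] e by (simp add: algebra_simps)
  finally show ?thesis .
qed

section \<open>Approximations on the balls and the fixed-point argument\<close>

text \<open>The error splits into two parts of at most 1/10 of \<open>norm (i x)\<close> each:
  moving the second argument from \<open>x\<close> to \<open>v\<close> is paid for by
  \<open>10 * L \<le> R'\<close>, and turning on the step size by
  \<open>10 * L * h \<le> 1\<close>.\<close>

lemma approximation_near:
  assumes appr: "approximation i \<phi> B R L H \<phi>t" and x: "x \<in> B" and h: "0 \<le> h" "h < H" "10 * L * h \<le> 1"
    and R: "0 < R" "R \<le> R'" "0 < L" "10 * L \<le> R'" and v: "v \<in> grad_ball i R' x"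
  shows "norm (\<phi>t x v h - \<phi> x) \<le> norm (i x) / 5"
proof -
  have xv: "x \<in> grad_ball i R x" "v \<in> grad_ball i R x" "norm (v - x) \<le> norm (i x) / R'"
    using v R frac_le[of "norm (i x)" "norm (i x)" R R']
    by (auto simp: grad_ball_def dist_norm norm_minus_commute)
  then have a: "norm (\<phi>t x v h - \<phi>t x x h) \<le> L * norm (v - x)"
    and b: "norm (\<phi>t x x h - \<phi>t x x 0) \<le> L * h * norm (i x)" and c: "\<phi>t x x 0 = \<phi> x"
    using appr x h unfolding approximation_def by (metis atLeastLessThan_iff)+
  have "L * norm (v - x) \<le> L * (norm (i x) / R')"
    using xv R by (intro mult_left_mono) auto
  also have "\<dots> \<le> norm (i x) / 10"
    using R mult_right_mono[OF R(4), of "norm (i x)"] by (simp add: field_simps)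
  finally have a': "norm (\<phi>t x v h - \<phi>t x x h) \<le> norm (i x) / 10"
    using a by linarith
  have "L * h * norm (i x) \<le> 1 / 10 * norm (i x)"
    using h by (intro mult_right_mono) auto
  with b c have b': "norm (\<phi>t x x h - \<phi> x) \<le> norm (i x) / 10"
    by simp
  show ?thesis
    using norm_triangle_le[of "\<phi>t x v h - \<phi>t x x h" "\<phi>t x x h - \<phi> x" "norm (i x) / 5"] a' b'
    by simp
qed

lemma grad_ball_mono:
  assumes "0 < R" "R \<le> R'"
  shows "grad_ball i R' x \<subseteq> grad_ball i R x"
  using frac_le[of "norm (i x)" "norm (i x)" R R'] assms
  by (auto simp: grad_ball_def)

text \<open>Each bound on \<open>h\<close> has its own task: \<open>10 * L * h \<le> 1\<close> keeps
  the approximations near their values at \<open>x\<close>, \<open>6 * C * R' * h \<le> 1\<close>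
  makes the fixed-point map preserve the ball, and \<open>(36 * C + 6) * L * h < 1\<close> makes it
  a contraction.\<close>

lemma projection_step_ex1:
  fixes i :: "real ^ 'n \<Rightarrow> real ^ 'n"
  assumes diff: "I differentiable_on UNIV" and cont: "continuous_on UNIV i" and i: "i = gradient I"
    and ix: "i x \<noteq> 0" and x: "x \<in> B"
    and f: "norm (f x) \<le> C1 * norm (i x)" and C: "C = C1 + 1 / 5"
    and R: "0 < R" "R \<le> R'" "0 < L" "10 * L \<le> R'"
    and ft: "approximation i f B R L H ft" and it: "approximation i i B R L H it"
    and consistent: "\<forall>u\<in>grad_ball i R' x. it u u 0 = i u"
    and h: "0 \<le> h" "h < H" "10 * L * h \<le> 1" "6 * C * R' * h \<le> 1" "(36 * C + 6) * L * h < 1"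
  shows "\<exists>!(y, l). y \<in> grad_ball i R' x \<and> \<bar>l\<bar> \<le> 11 / 5 * C * h \<and> projection_step I ft it h x y l"
proof -
  let ?S = "grad_ball i R' x" and ?m = "norm (i x)"
  let ?g = "mean_gradient I x"
  let ?q = "\<lambda>y. multiplier (ft x y h) (?g y) (it x y h)"
  let ?T = "\<lambda>y. x + h *\<^sub>R (ft x y h - ?q y *\<^sub>R it x y h)"
  have m: "?m > 0"
    using ix by simp
  have "C1 * ?m \<ge> 0"
    using f norm_ge_zero order_trans by blast
  then have C0: "C \<ge> 0"
    using m C by (simp add: zero_le_mult_iff)
  have SR: "?S \<subseteq> grad_ball i R x"
    using grad_ball_mono R by blast
  have xS: "x \<in> ?S"
    using R by (simp add: grad_ball_def)
  have dist_x: "norm (y - x) \<le> ?m / R'" if "y \<in> ?S" for y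
    using that by (simp add: grad_ball_def dist_norm norm_minus_commute)
  have lip_ft: "norm (ft x u h - ft x w h) \<le> L * norm (u - w)"
    and lip_it: "norm (it x u h - it x w h) \<le> L * norm (u - w)" if "u \<in> ?S" "w \<in> ?S" for u w
    using ft it x h that SR xS unfolding approximation_def by (meson atLeastLessThan_iff subsetD)+
  \<comment> \<open>The gradient inherits its Lipschitz bound from \<open>it\<close> at step size 0:
    change one argument at a time between the diagonal points, where \<open>consistent\<close>
    identifies \<open>it\<close> with \<open>i\<close> even outside \<open>B\<close>.\<close>
  have lip_i: "norm (i u - i w) \<le> 2 * L * norm (u - w)" if uw: "u \<in> ?S" "w \<in> ?S" for u w
  proof -
    have uw': "u \<in> grad_ball i R x" "w \<in> grad_ball i R x" "0 \<in> {0..<H}"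
      using uw SR h by auto
    have "norm (it u u 0 - it w u 0) \<le> L * norm (u - w)" "norm (it w u 0 - it w w 0) \<le> L * norm (u - w)"
      using it x uw' unfolding approximation_def by meson+
    moreover have "it u u 0 = i u" "it w w 0 = i w"
      using consistent uw by auto
    ultimately show ?thesis
      using norm_triangle_ineq[of "i u - it w u 0" "it w u 0 - i w"] by simp
  qed
  have lip_g: "norm (?g u - ?g w) \<le> 2 * L * norm (u - w)" if "u \<in> ?S" "w \<in> ?S" for u w
    using norm_mean_gradient_diff_le[of I ?S "2 * L" x u w] cont lip_i that xS R
    by (simp add: i grad_ball_def)
  have near_g: "norm (?g y - i x) \<le> ?m / 5" if "y \<in> ?S" for y
  proof -
    have "norm (?g y - i x) \<le> 2 * L * norm (y - x)"
      using lip_g[OF that xS] by (simp add: mean_gradient_refl i)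
    also have "\<dots> \<le> 2 * L * (?m / R')"
      using dist_x[OF that] R by (intro mult_left_mono) auto
    also have "\<dots> \<le> ?m / 5"
      using R mult_right_mono[OF R(4), of ?m] by (simp add: field_simps)
    finally show ?thesis .
  qed
  have near_it: "norm (it x y h - i x) \<le> ?m / 5" if "y \<in> ?S" for y
    using approximation_near[OF it x h(1-3) R that] .
  have bound_ft: "norm (ft x y h) \<le> C * ?m" if "y \<in> ?S" for y
    using approximation_near[OF ft x h(1-3) R that] f norm_triangle_sub[of "ft x y h" "f x"]
    by (simp add: C algebra_simps)
  have bound_q: "\<bar>?q y\<bar> \<le> 11 / 5 * C" if "y \<in> ?S" for y
    using abs_multiplier_le[OF ix bound_ft near_g near_it] that by blast
  have Dpos: "?g y \<bullet> it x y h > 0" if "y \<in> ?S" for y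
    by (rule less_le_trans[OF _ inner_ge_near[OF near_g[OF that] near_it[OF that]]]) (use m in simp)
  \<comment> \<open>On the ball the bound on \<open>l\<close> holds automatically for the multiplier
    that the constraint forces, so pairs solving the scheme correspond exactly to fixed
    points.\<close>
  have char: "\<bar>l\<bar> \<le> 11 / 5 * C * h \<and> projection_step I ft it h x y l \<longleftrightarrow> ?T y = y \<and> l = - h * ?q y"
    if y: "y \<in> ?S" for y l
  proof -
    have I: "I y = I x \<longleftrightarrow> ?g y \<bullet> (y - x) = 0"
      using diff_eq_mean_gradient[OF diff cont[unfolded i], of y x] by linarith
    have l: "?g y \<bullet> (h *\<^sub>R ft x y h + l *\<^sub>R it x y h) = 0 \<longleftrightarrow> l = - h * ?q y"
      using Dpos[OF y] by (simp add: multiplier_def inner_add_right field_simps add_eq_0_iff)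
    have "\<bar>- h * ?q y\<bar> \<le> 11 / 5 * C * h"
      using mult_left_mono[OF bound_q[OF y] h(1)] h(1) by (simp add: abs_mult mult_ac)
    moreover have "I y = I x \<longleftrightarrow> l = - h * ?q y" if "y = x + h *\<^sub>R ft x y h + l *\<^sub>R it x y h"
    proof -
      have "y - x = h *\<^sub>R ft x y h + l *\<^sub>R it x y h"
        using that by (metis add.assoc add_diff_cancel_left')
      then show ?thesis
        using I l by simp
    qed
    moreover have "?T y = x + h *\<^sub>R ft x y h + (- h * ?q y) *\<^sub>R it x y h"
      by (simp add: algebra_simps)
    ultimately show ?thesis
      unfolding projection_step_def by metis
  qed
  have "\<exists>!y\<in>?S. ?T y = y"
  proof (rule Banach_fix)
    show "complete ?S" "?S \<noteq> {}"
      using xS by (auto simp: grad_ball_def complete_eq_closed)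
    show "0 \<le> (36 * C + 6) * L * h" "(36 * C + 6) * L * h < 1"
      using h C0 R by auto
    show "?T ` ?S \<subseteq> ?S"
    proof (rule image_subsetI)
      fix y assume y: "y \<in> ?S"
      have "norm (?q y *\<^sub>R it x y h) \<le> 11 / 5 * C * (6 / 5 * ?m)"
        unfolding norm_scaleR using bound_q[OF y] norm_le_near[OF near_it[OF y]] C0
        by (intro mult_mono) auto
      \<comment> \<open>1 + (11/5)(6/5) = 91/25 is rounded up to 6, the constant in the step-size
        restriction.\<close>
      then have "norm (ft x y h - ?q y *\<^sub>R it x y h) \<le> 6 * (C * ?m)"
        using norm_triangle_ineq4[of "ft x y h" "?q y *\<^sub>R it x y h"] bound_ft[OF y]
          mult_nonneg_nonneg[OF C0 norm_ge_zero[of "i x"]] by linarith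
      then have "h * norm (ft x y h - ?q y *\<^sub>R it x y h) \<le> h * (6 * (C * ?m))"
        using h by (intro mult_left_mono) auto
      also have "\<dots> \<le> ?m / R'"
        using R mult_right_mono[OF h(4), of ?m] by (simp add: field_simps)
      finally show "?T y \<in> ?S"
        using h by (simp add: grad_ball_def dist_norm)
    qed
    fix u w assume uw: "u \<in> ?S" "w \<in> ?S"
    let ?F = "\<lambda>y. ft x y h - ?q y *\<^sub>R it x y h"
    have "norm (?F u - ?F w) \<le> (36 * C + 6) * (L * norm (u - w))"
      using uw lip_g[OF uw]
      by (intro norm_multiplier_correction_diff_le[OF ix] bound_ft near_g near_it lip_ft lip_it) auto
    then have "h * norm (?F u - ?F w) \<le> h * ((36 * C + 6) * (L * norm (u - w)))"
      using h by (intro mult_left_mono) auto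
    moreover have "?T u - ?T w = h *\<^sub>R (?F u - ?F w)"
      by (simp add: algebra_simps)
    ultimately show "dist (?T u) (?T w) \<le> (36 * C + 6) * L * h * dist u w"
      using h(1) by (simp add: dist_norm mult_ac)
  qed
  then obtain y where y: "y \<in> ?S" "?T y = y" and uniq: "\<And>z. z \<in> ?S \<Longrightarrow> ?T z = z \<Longrightarrow> z = y"
    by blast
  show ?thesis
  proof (rule ex1I[of _ "(y, - h * ?q y)"])
    show "case (y, - h * ?q y) of (y, l) \<Rightarrow>
        y \<in> ?S \<and> \<bar>l\<bar> \<le> 11 / 5 * C * h \<and> projection_step I ft it h x y l"
      using char[OF y(1)] y by simp
    fix z assume z: "case z of (y, l) \<Rightarrow>
        y \<in> ?S \<and> \<bar>l\<bar> \<le> 11 / 5 * C * h \<and> projection_step I ft it h x y l"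
    obtain w l where zw: "z = (w, l)"
      by (cases z)
    with z have w: "w \<in> ?S" and "?T w = w \<and> l = - h * ?q w"
      using char[of w l] by auto
    with uniq[OF w] zw show "z = (y, - h * ?q y)"
      by simp
  qed
qed

section \<open>Critical points and the combined statement\<close>

text \<open>All bounds scale with \<open>norm (i x)\<close>, so at a critical point both
  approximations vanish at \<open>(x, x, h)\<close> and the multiplier is arbitrary.\<close>

lemma projection_step_critical:
  assumes ix: "i x = 0" and x: "x \<in> B" and f: "norm (f x) \<le> C1 * norm (i x)"
    and ft: "approximation i f B R L H ft" and it: "approximation i i B R L H it"
    and R: "0 < R" and h: "0 \<le> h" "h < H"
  shows "projection_step I ft it h x x l"
proof -
  have "x \<in> grad_ball i R x" "h \<in> {0..<H}"
    using R h by (auto simp: grad_ball_def)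
  then have "ft x x 0 = f x" "norm (ft x x h - ft x x 0) \<le> L * h * norm (i x)"
    "it x x 0 = i x" "norm (it x x h - it x x 0) \<le> L * h * norm (i x)"
    using ft it x unfolding approximation_def by blast+
  then show ?thesis
    using ix f by (simp add: projection_step_def)
qed

text \<open>Uniqueness of the pair is restricted to \<open>i x \<noteq> 0\<close> or
  \<open>h = 0\<close>, since at a critical point with \<open>h > 0\<close> every multiplier within
  the bound solves the scheme. The point \<open>x'\<close> is unique in all cases.\<close>

theorem theorem4:
  fixes f i :: "real ^ 'n \<Rightarrow> real ^ 'n"
    and I :: "real ^ 'n \<Rightarrow> real"
    and ft it :: "real ^ 'n \<Rightarrow> real ^ 'n \<Rightarrow> real \<Rightarrow> real ^ 'n"
    and B :: "(real ^ 'n) set"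
    and C1 C2 R L H R' H' :: real
  assumes f_lipschitz: "locally_lipschitz f"
    and integral: "first_integral f I"
    and morse: "morse I"
    and i_def: "i = gradient I"
    and i_lipschitz: "locally_lipschitz i"
    and bounded: "bounded B"
    and C1: "\<forall>x\<in>B. norm (f x) \<le> C1 * norm (i x)"
    and C2: "C2 = C1 + 1 / 5"
    and pos: "R > 0" "L > 0" "H > 0"
    and ft: "approximation i f B R L H ft"
    and it: "approximation i i B R L H it"
    and R': "R' = max R (10 * L)"
    and H': "H' = Min {H, 1 / (10 * L), 1 / (6 * C2 * R'), 1 / ((36 * C2 + 6) * L)}"
    and it_consistent: "\<forall>x\<in>B. \<forall>u\<in>grad_ball i R' x. it u u 0 = i u"
  shows "\<forall>x\<in>B. \<forall>h\<in>{0..<H'}.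
      (\<exists>!x'. x' \<in> grad_ball i R' x
          \<and> (\<exists>l. \<bar>l\<bar> \<le> 11 / 5 * C2 * h \<and> projection_step I ft it h x x' l))
    \<and> (i x \<noteq> 0 \<or> h = 0 \<longrightarrow>
        (\<exists>!(x', l). x' \<in> grad_ball i R' x
          \<and> \<bar>l\<bar> \<le> 11 / 5 * C2 * h \<and> projection_step I ft it h x x' l))"
proof (intro ballI)
  fix x h assume x: "x \<in> B" and h: "h \<in> {0..<H'}"
  let ?P = "\<lambda>y l. y \<in> grad_ball i R' x \<and> \<bar>l\<bar> \<le> 11 / 5 * C2 * h \<and> projection_step I ft it h x y l"
  have R1: "0 < R" "R \<le> R'" "0 < L" "10 * L \<le> R'"
    using R' pos by auto
  have fx: "norm (f x) \<le> C1 * norm (i x)"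
    using C1 x by blast
  have h0: "0 \<le> h" and h1: "h < H" and h2: "h < 1 / (10 * L)" and h3: "h < 1 / (6 * C2 * R')"
    and h4: "h < 1 / ((36 * C2 + 6) * L)"
    using h by (simp_all add: H')
  \<comment> \<open>Otherwise \<open>1 / (6 * C2 * R')\<close> is at most \<open>0\<close> (it is \<open>1 / 0 = 0\<close> for \<open>C2 = 0\<close>) and no step size is admissible.\<close>
  have "0 < 6 * C2 * R'"
    using le_less_trans[OF h0 h3] by (simp only: zero_less_divide_1_iff)
  then have C2pos: "0 < C2"
    using R1 by (simp add: zero_less_mult_iff)
  have h': "10 * L * h \<le> 1" "6 * C2 * R' * h \<le> 1" "(36 * C2 + 6) * L * h < 1"
  proof -
    show "10 * L * h \<le> 1"
      using h2 pos by (simp add: field_simps)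
    show "6 * C2 * R' * h \<le> 1"
      using h3 \<open>0 < 6 * C2 * R'\<close> by (simp add: pos_less_divide_eq mult.commute)
    have "0 < (36 * C2 + 6) * L"
      using C2pos pos by simp
    then show "(36 * C2 + 6) * L * h < 1"
      using h4 by (simp add: pos_less_divide_eq mult.commute)
  qed
  show "(\<exists>!x'. x' \<in> grad_ball i R' x
          \<and> (\<exists>l. \<bar>l\<bar> \<le> 11 / 5 * C2 * h \<and> projection_step I ft it h x x' l))
    \<and> (i x \<noteq> 0 \<or> h = 0 \<longrightarrow> (\<exists>!(x', l). ?P x' l))"
  proof (cases "i x = 0")
    case True
    then have S: "grad_ball i R' x = {x}"
      by (simp add: grad_ball_def)
    have step: "projection_step I ft it h x x l" for l
      by (rule projection_step_critical[where i = i, OF True x fx ft it pos(1) h0 h1])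
    have "\<bar>0\<bar> \<le> 11 / 5 * C2 * h"
      using C2pos h0 by simp
    then have "\<exists>!y. y \<in> grad_ball i R' x \<and> (\<exists>l. \<bar>l\<bar> \<le> 11 / 5 * C2 * h \<and> projection_step I ft it h x y l)"
      unfolding S by (intro ex1I[of _ x] conjI exI[of _ 0] step) simp_all
    \<comment> \<open>At \<open>h = 0\<close> the bound on the multiplier leaves only
      \<open>l = 0\<close>.\<close>
    moreover have "\<exists>!(x', l). ?P x' l" if "h = 0"
      using that S step by (intro ex1I[of _ "(x, 0)"]) auto
    ultimately show ?thesis
      using True by blast
  next
    case False
    have "k_times_cont_diff (Suc 0) I"
      using morse unfolding morse_def smooth_def by blast
    then have diff: "I differentiable_on UNIV"
      by simp
    have cont: "continuous_on UNIV i"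
      using i_lipschitz local_lipschitz_continuous_on unfolding locally_lipschitz_def by blast
    have ex1: "\<exists>!(x', l). ?P x' l"
      using it_consistent x
      by (intro projection_step_ex1[OF diff cont i_def False x fx C2 R1 ft it _ h0 h1 h']) blast
    then obtain y l where "?P y l" and "\<And>z k. ?P z k \<Longrightarrow> (z, k) = (y, l)"
      by (auto elim!: ex1E)
    then have "\<exists>!x'. x' \<in> grad_ball i R' x
          \<and> (\<exists>l. \<bar>l\<bar> \<le> 11 / 5 * C2 * h \<and> projection_step I ft it h x x' l)"
      by blast
    with ex1 show ?thesis
      by blast
  qed
qed

end
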